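(* Let $\alpha>0$, let $F$ be a continuous distribution function of a positive random variable $X$ with $m(\alpha)=E(X^\alpha)<\infty$, and let $R(x)=\sum_{n=0}^{\infty}F^{\boxtimes n}(x)$ be the Kendall renewal function of $F$. Then for $x>0$ $$R(x)=\frac{2}{\overline{G}_F(x)}-\frac{\overline{F}(x)}{\overline{G}_F^{2}(x)},$$ and $$\lim_{x\to\infty}\frac{R(x)}{x^{\alpha}}=\frac{2}{m(\alpha)}.$$
   Context: Fix $\alpha>0$. $X$ is a positive random variable with distribution function $F(x)=P(X\le x)$, $F(0-)=0$, $F$ continuous; $\overline{F}=1-F$; $m(\alpha)=\int_0^\infty y^\alpha\,dF(y)$. The Williamson transform ($G$-transform) of a distribution function $F$ with $F(0-)=0$ is $G_F(x)=\int_0^x\bigl(1-(t/x)^\alpha\bigr)\,dF(t)$, $x>0$, and $\overline{G}_F=1-G_F$. The Kendall convolution $F_1\boxtimes F_2$ of two distribution functions with $F_i(0-)=0$ is the distribution function $F_3$ (with $F_3(0-)=0$) determined by $G_{F_3}(x)=G_{F_1}(x)G_{F_2}(x)$. The $n$-fold Kendall convolution $F^{\boxtimes n}$ is thus the distribution function with $G$-transform $G_F^n$, and $F^{\boxtimes 0}$ is the distribution function of the point mass at $0$. *)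

theory Defs
  imports "HOL-Probability.Probability"
begin

text \<open>
  Distribution functions are right-continuous functions on the reals, as given by
  \<^const>\<open>cdf\<close>. Integrals with respect to \<open>dF\<close> are Lebesgue integrals with respect to
  \<^term>\<open>interval_measure F\<close>, the Lebesgue-Stieltjes measure of \<open>F\<close>.
\<close>

definition nonneg_distribution_function :: "(real \<Rightarrow> real) \<Rightarrow> bool" where
  "nonneg_distribution_function F \<longleftrightarrow>
     (\<exists>\<mu>. real_distribution \<mu> \<and> F = cdf \<mu>) \<and> (F \<longlongrightarrow> 0) (at_left 0)"

definition moment :: "real \<Rightarrow> (real \<Rightarrow> real) \<Rightarrow> real" where
  "moment \<alpha> F = (LINT y:{0..}|interval_measure F. y powr \<alpha>)"

text \<open>
  The domain of integration is the closed interval, so that an atom at \<open>0\<close> contributes its full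
  mass; in particular the transform of the point mass at \<open>0\<close> is constantly \<open>1\<close>. The transform is
  only meaningful for \<open>x > 0\<close>.
\<close>

definition williamson :: "real \<Rightarrow> (real \<Rightarrow> real) \<Rightarrow> real \<Rightarrow> real" where
  "williamson \<alpha> F x = (LINT t:{0..x}|interval_measure F. 1 - (t / x) powr \<alpha>)"

definition kendall_conv :: "real \<Rightarrow> (real \<Rightarrow> real) \<Rightarrow> (real \<Rightarrow> real) \<Rightarrow> (real \<Rightarrow> real)" where
  "kendall_conv \<alpha> F1 F2 = (THE F3. nonneg_distribution_function F3 \<and>
     (\<forall>x>0. williamson \<alpha> F3 x = williamson \<alpha> F1 x * williamson \<alpha> F2 x))"

primrec kendall_power :: "real \<Rightarrow> (real \<Rightarrow> real) \<Rightarrow> nat \<Rightarrow> (real \<Rightarrow> real)" where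
  "kendall_power \<alpha> F 0 = cdf (return borel 0)"
| "kendall_power \<alpha> F (Suc n) = kendall_conv \<alpha> (kendall_power \<alpha> F n) F"

definition kendall_renewal :: "real \<Rightarrow> (real \<Rightarrow> real) \<Rightarrow> real \<Rightarrow> real" where
  "kendall_renewal \<alpha> F x = (\<Sum>n. kendall_power \<alpha> F n x)"

end

theory Submission
  imports Defs
begin

text \<open>
  Everything rests on the function
  \<open>U x = x powr \<alpha> * G x = \<integral> (x powr \<alpha> - t powr \<alpha>) dF t\<close> over \<open>{0..x}\<close>, where \<open>G\<close> is the Williamson
  transform of \<open>F\<close>: measured in the variable \<open>x powr \<alpha>\<close>, it is a primitive of \<open>F\<close>. This is read off
  directly from the increments of \<open>U\<close>, which lie between \<open>(y powr \<alpha> - x powr \<alpha>) * F x\<close> and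
  \<open>(y powr \<alpha> - x powr \<alpha>) * F y\<close> (\<open>williamson_primitive_increment\<close>). Two consequences are used. Right
  continuity recovers \<open>F\<close> from the right derivative of \<open>U\<close>, so that the transform is injective
  (\<open>williamson_inject\<close>). And if \<open>F\<close> is continuous, then \<open>G\<close> is differentiable with
  \<open>x * G' x / \<alpha> = F x - G x\<close>.

  Inverting the transform of \<open>F\<^sup>\<boxtimes>\<^sup>n\<close> in this way suggests
  \<open>G^n + (x / \<alpha>) * (G^n)' = n * G^(n-1) * F - (n - 1) * G^n\<close> for \<open>n \<ge> 1\<close>. Indeed this is
  a distribution function: as a polynomial in \<open>(G, F)\<close> it increases in both arguments while
  \<open>0 \<le> G \<le> F\<close>. Its transform is \<open>G^n\<close>, because the two primitives have the same
  derivative on the positive half-line and both vanish at \<open>0\<close>. By injectivity it is the convolution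
  power (\<open>kendall_power_Suc\<close>).

  Since \<open>F\<close> has no mass at \<open>0\<close>, \<open>G x < 1\<close> for \<open>x > 0\<close>, and summing geometric series gives the formula
  for the renewal function. Dividing it by \<open>x powr \<alpha>\<close> yields
  \<open>2 / V - x powr \<alpha> * (1 - F x) / V\<^sup>2\<close> with \<open>V = x powr \<alpha> * (1 - G x) = \<integral> min (x powr \<alpha>) (t powr \<alpha>) dF t\<close>.
  By dominated convergence \<open>V\<close> tends to the moment, and \<open>x powr \<alpha> * (1 - F x)\<close> tends to \<open>0\<close>.
\<close>

section \<open>Distribution functions on the half-line\<close>

lemma nonneg_distribution_function_measure:
  assumes "nonneg_distribution_function F"
  shows "real_distribution (interval_measure F)" and "cdf (interval_measure F) = F"
proof -
  obtain \<mu> where mu: "real_distribution \<mu>" and F: "F = cdf \<mu>"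
    using assms unfolding nonneg_distribution_function_def by blast
  interpret real_distribution \<mu> by (rule mu)
  show "real_distribution (interval_measure F)"
    unfolding F
    by (intro real_distribution_interval_measure)
      (simp_all add: cdf_nondecreasing cdf_is_right_cont cdf_lim_at_bot cdf_lim_at_top_prob)
  show "cdf (interval_measure F) = F"
    unfolding F
    by (intro cdf_interval_measure)
      (simp_all add: cdf_nondecreasing cdf_is_right_cont cdf_lim_at_bot)
qed

lemma nonneg_distribution_functionI:
  assumes mono: "\<And>x y. x \<le> y \<Longrightarrow> F x \<le> F y"
    and cont: "\<And>x. continuous (at_right x) F"
    and neg: "\<And>x. x < 0 \<Longrightarrow> F x = 0"
    and top: "(F \<longlongrightarrow> 1) at_top"
  shows "nonneg_distribution_function F"
proof -
  have bot: "(F \<longlongrightarrow> 0) at_bot"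
    by (rule tendsto_eventually) (use eventually_gt_at_bot neg in \<open>auto simp: eventually_at_bot_dense\<close>)
  have "(F \<longlongrightarrow> 0) (at_left 0)"
    by (rule tendsto_eventually) (auto simp: eventually_at_filter neg)
  moreover have "real_distribution (interval_measure F)"
    using mono cont bot top by (rule real_distribution_interval_measure)
  moreover have "cdf (interval_measure F) = F"
    using mono cont bot by (rule cdf_interval_measure)
  ultimately show ?thesis
    unfolding nonneg_distribution_function_def by metis
qed

lemma
  assumes "nonneg_distribution_function F"
  shows nonneg_distribution_function_mono: "x \<le> y \<Longrightarrow> F x \<le> F y"
    and nonneg_distribution_function_right_cont: "continuous (at_right x) F"
    and nonneg_distribution_function_nonneg: "0 \<le> F x"
    and nonneg_distribution_function_le_1: "F x \<le> 1"
    and nonneg_distribution_function_at_top: "(F \<longlongrightarrow> 1) at_top"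
proof -
  interpret real_distribution "interval_measure F"
    using assms by (rule nonneg_distribution_function_measure)
  note F = nonneg_distribution_function_measure(2)[OF assms]
  show "x \<le> y \<Longrightarrow> F x \<le> F y" "continuous (at_right x) F" "0 \<le> F x" "F x \<le> 1" "(F \<longlongrightarrow> 1) at_top"
    using cdf_nondecreasing[of x y] cdf_is_right_cont[of x] cdf_nonneg[of x] cdf_bounded_prob[of x]
      cdf_lim_at_top_prob
    unfolding F by auto
qed

lemma nonneg_distribution_function_neg:
  assumes "nonneg_distribution_function F" "x < 0"
  shows "F x = 0"
proof -
  have "(F \<longlongrightarrow> 0) (at_left 0)"
    using assms(1) by (simp add: nonneg_distribution_function_def)
  moreover have "eventually (\<lambda>y. F x \<le> F y) (at_left 0)"
    using eventually_at_left[OF assms(2)] assms(2) nonneg_distribution_function_mono[OF assms(1)]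
    by (metis less_imp_le)
  ultimately have "F x \<le> 0"
    by (rule tendsto_lowerbound) simp
  with nonneg_distribution_function_nonneg[OF assms(1)] show ?thesis
    by (simp add: order_antisym)
qed

lemma interval_measure_lessThan_0:
  assumes "nonneg_distribution_function F"
  shows "measure (interval_measure F) {..<0} = 0"
proof -
  interpret real_distribution "interval_measure F"
    using assms by (rule nonneg_distribution_function_measure)
  show ?thesis
    using cdf_at_left[of 0] assms nonneg_distribution_function_measure(2)[OF assms]
    unfolding nonneg_distribution_function_def
    by (metis tendsto_unique trivial_limit_at_left_real)
qed

lemma interval_measure_atLeastAtMost_0:
  assumes "nonneg_distribution_function F"
  shows "measure (interval_measure F) {0..x} = F x"
proof -
  interpret real_distribution "interval_measure F"
    using assms by (rule nonneg_distribution_function_measure)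
  note F = nonneg_distribution_function_measure(2)[OF assms]
  show ?thesis
  proof (cases "x < 0")
    case True
    then show ?thesis using assms by (simp add: nonneg_distribution_function_neg)
  next
    case False
    then have "{..x} = {..<0} \<union> {0..x}" by auto
    then have "measure (interval_measure F) {..x}
        = measure (interval_measure F) {..<0} + measure (interval_measure F) {0..x}"
      by (simp add: finite_measure_Union disjoint_iff)
    moreover have "measure (interval_measure F) {..x} = F x"
      using F by (metis cdf_def2)
    ultimately show ?thesis by (simp add: interval_measure_lessThan_0[OF assms])
  qed
qed

lemma AE_interval_measure_nonneg:
  assumes "nonneg_distribution_function F"
  shows "AE t in interval_measure F. 0 \<le> t"
proof -
  interpret real_distribution "interval_measure F"
    using assms by (rule nonneg_distribution_function_measure)
  have "AE t in interval_measure F. t \<notin> {..<0}"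
    by (intro AE_not_in)
      (simp add: null_sets_def emeasure_eq_measure interval_measure_lessThan_0[OF assms])
  then show ?thesis by eventually_elim simp
qed

section \<open>The primitive of a distribution function\<close>

text \<open>
  The transform scaled by \<open>x powr \<alpha>\<close>. The scaling removes the variable \<open>x\<close> from the subtracted term of
  the integrand, and gives a meaningful value also at \<open>x = 0\<close>.
\<close>

definition williamson_primitive :: "real \<Rightarrow> (real \<Rightarrow> real) \<Rightarrow> real \<Rightarrow> real" where
  "williamson_primitive \<alpha> F x = (LINT t:{0..x}|interval_measure F. x powr \<alpha> - t powr \<alpha>)"

lemma williamson_primitive_eq:
  assumes "x > 0"
  shows "williamson_primitive \<alpha> F x = x powr \<alpha> * williamson \<alpha> F x"
proof -
  have "x powr \<alpha> * williamson \<alpha> F x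
      = (LINT t:{0..x}|interval_measure F. x powr \<alpha> * (1 - (t / x) powr \<alpha>))"
    unfolding williamson_def by simp
  also have "\<dots> = williamson_primitive \<alpha> F x"
    unfolding williamson_primitive_def set_lebesgue_integral_def
    by (rule Bochner_Integration.integral_cong)
      (use assms in \<open>auto simp: indicator_def powr_divide algebra_simps\<close>)
  finally show ?thesis by simp
qed

lemma set_integrable_powr_deficit:
  assumes "nonneg_distribution_function F" "\<alpha> > 0"
  shows "set_integrable (interval_measure F) {0..x} (\<lambda>t. x powr \<alpha> - t powr \<alpha>)"
proof -
  interpret real_distribution "interval_measure F"
    using assms(1) by (rule nonneg_distribution_function_measure)
  show ?thesis
    unfolding set_integrable_def
  proof (rule integrable_const_bound[of _ "x powr \<alpha>"])
    show "AE t in interval_measure F.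
        norm (indicator {0..x} t *\<^sub>R (x powr \<alpha> - t powr \<alpha>)) \<le> x powr \<alpha>"
      using assms(2) by (auto intro!: AE_I2 simp: indicator_def powr_mono2)
  qed measurable
qed

text \<open>
  When \<open>x\<close> grows to \<open>y\<close>, the integrand grows by exactly \<open>y powr \<alpha> - x powr \<alpha>\<close> on \<open>{0..x}\<close>, by at most
  that on \<open>{x<..y}\<close>, and not at all elsewhere. These bounds take the place of the Fubini formula
  \<open>U x = \<alpha> * \<integral> s powr (\<alpha> - 1) * F s ds\<close> over \<open>{0..x}\<close>.
\<close>

lemma williamson_primitive_increment:
  assumes F: "nonneg_distribution_function F" and "\<alpha> > 0" and "0 \<le> x" "x \<le> y"
  shows "(y powr \<alpha> - x powr \<alpha>) * F x \<le> williamson_primitive \<alpha> F y - williamson_primitive \<alpha> F x"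
    and "williamson_primitive \<alpha> F y - williamson_primitive \<alpha> F x \<le> (y powr \<alpha> - x powr \<alpha>) * F y"
proof -
  interpret real_distribution "interval_measure F"
    using F by (rule nonneg_distribution_function_measure)
  let ?\<mu> = "interval_measure F"
  let ?h = "\<lambda>x t. indicator {0..x} t *\<^sub>R (x powr \<alpha> - t powr \<alpha>)"
  have int: "integrable ?\<mu> (?h x)" "integrable ?\<mu> (?h y)"
    using set_integrable_powr_deficit[OF F \<open>\<alpha> > 0\<close>] unfolding set_integrable_def by auto
  have diff: "williamson_primitive \<alpha> F y - williamson_primitive \<alpha> F x = (LINT t|?\<mu>. ?h y t - ?h x t)"
    unfolding williamson_primitive_def set_lebesgue_integral_def
    by (rule Bochner_Integration.integral_diff[symmetric]) (rule int)+
  have mass: "(LINT t|?\<mu>. c * indicator {0..z} t) = c * F z" for c z :: real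
    using interval_measure_atLeastAtMost_0[OF F, of z] by simp
  have const: "integrable ?\<mu> (\<lambda>t. c * indicator {0..z} t)" for c z :: real
    by (intro integrable_mult_right integrable_real_indicator) (auto simp: less_top[symmetric])
  have xy: "x powr \<alpha> \<le> y powr \<alpha>"
    using assms by (intro powr_mono2) auto
  have ty: "t powr \<alpha> \<le> z powr \<alpha>" if "0 \<le> t" "t \<le> z" for t z
    using that assms by (intro powr_mono2) auto
  have xt: "x powr \<alpha> \<le> t powr \<alpha>" if "x \<le> t" for t
    using that assms by (intro powr_mono2) auto
  have lower: "(y powr \<alpha> - x powr \<alpha>) * indicator {0..x} t \<le> ?h y t - ?h x t" for t
    using \<open>0 \<le> x\<close> \<open>x \<le> y\<close> ty by (auto simp: indicator_def)
  have upper: "?h y t - ?h x t \<le> (y powr \<alpha> - x powr \<alpha>) * indicator {0..y} t" for t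
    using \<open>0 \<le> x\<close> \<open>x \<le> y\<close> xt[of t] by (auto simp: indicator_def)
  show "(y powr \<alpha> - x powr \<alpha>) * F x \<le> williamson_primitive \<alpha> F y - williamson_primitive \<alpha> F x"
    unfolding diff mass[symmetric]
    by (rule integral_mono[OF const Bochner_Integration.integrable_diff[OF int(2,1)] lower])
  show "williamson_primitive \<alpha> F y - williamson_primitive \<alpha> F x \<le> (y powr \<alpha> - x powr \<alpha>) * F y"
    unfolding diff mass[symmetric]
    by (rule integral_mono[OF Bochner_Integration.integrable_diff[OF int(2,1)] const upper])
qed

lemma williamson_primitive_0:
  "\<alpha> > 0 \<Longrightarrow> williamson_primitive \<alpha> F 0 = 0"
  unfolding williamson_primitive_def set_lebesgue_integral_def
  by (rule integral_eq_zero_AE) (auto simp: indicator_def)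

lemma williamson_primitive_bounds:
  assumes "nonneg_distribution_function F" "\<alpha> > 0" "0 \<le> x"
  shows "0 \<le> williamson_primitive \<alpha> F x" "williamson_primitive \<alpha> F x \<le> x powr \<alpha> * F x"
proof -
  have "0 \<le> x powr \<alpha> * F 0"
    using nonneg_distribution_function_nonneg[OF assms(1)] by simp
  then show "0 \<le> williamson_primitive \<alpha> F x" "williamson_primitive \<alpha> F x \<le> x powr \<alpha> * F x"
    using williamson_primitive_increment[OF assms(1,2), of 0 x] assms
    by (auto simp: williamson_primitive_0)
qed

text \<open>
  By the increment bounds the difference quotient of the primitive differs from that of
  \<open>x powr \<alpha>\<close> times \<open>F x\<close> by at most the quotient times \<open>\<bar>F y - F x\<bar>\<close>. The set \<open>S\<close> allows the
  one-sided version, for which right continuity is enough, along with the two-sided one.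
\<close>

lemma williamson_primitive_has_derivative:
  assumes F: "nonneg_distribution_function F" and "\<alpha> > 0" "x > 0"
    and cont: "continuous (at x within S) F"
  shows "(williamson_primitive \<alpha> F has_real_derivative \<alpha> * x powr (\<alpha> - 1) * F x) (at x within S)"
proof -
  let ?U = "williamson_primitive \<alpha> F"
  let ?q = "\<lambda>y. (y powr \<alpha> - x powr \<alpha>) / (y - x)"
  have q: "(?q \<longlongrightarrow> \<alpha> * x powr (\<alpha> - 1)) (at x within S)"
    using has_field_derivative_at_within[OF has_real_derivative_powr[OF \<open>x > 0\<close>]]
    by (simp add: has_field_derivative_iff)
  have F0: "((\<lambda>y. \<bar>?q y\<bar> * \<bar>F y - F x\<bar>) \<longlongrightarrow> \<bar>\<alpha> * x powr (\<alpha> - 1)\<bar> * \<bar>F x - F x\<bar>) (at x within S)"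
    using cont unfolding continuous_within by (intro tendsto_intros q)
  have close: "\<bar>?U y - ?U x - (y powr \<alpha> - x powr \<alpha>) * F x\<bar> \<le> \<bar>y powr \<alpha> - x powr \<alpha>\<bar> * \<bar>F y - F x\<bar>"
    if "y > 0" for y
  proof (cases "x \<le> y")
    case True
    have "x powr \<alpha> \<le> y powr \<alpha>" "F x \<le> F y"
      using True assms nonneg_distribution_function_mono[OF F] by (auto intro: powr_mono2)
    then show ?thesis
      using williamson_primitive_increment[OF F \<open>\<alpha> > 0\<close>, of x y] True \<open>x > 0\<close>
      by (simp add: algebra_simps)
  next
    case False
    have le: "y powr \<alpha> \<le> x powr \<alpha>" "F y \<le> F x"
      using False assms that nonneg_distribution_function_mono[OF F] by (auto intro: powr_mono2)
    then have abs: "\<bar>y powr \<alpha> - x powr \<alpha>\<bar> = x powr \<alpha> - y powr \<alpha>" "\<bar>F y - F x\<bar> = F x - F y"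
      by auto
    show ?thesis
      unfolding abs abs_le_iff
      using williamson_primitive_increment[OF F \<open>\<alpha> > 0\<close>, of y x] False \<open>y > 0\<close>
      by (simp add: algebra_simps)
  qed
  have "eventually (\<lambda>y. y > 0) (nhds x)"
    using \<open>x > 0\<close> by (rule eventually_nhds_in_open[OF open_greaterThan, simplified])
  then have pos: "eventually (\<lambda>y. y > 0 \<and> y \<noteq> x) (at x within S)"
    unfolding eventually_at_filter by eventually_elim simp
  have "((\<lambda>y. (?U y - ?U x) / (y - x) - ?q y * F x) \<longlongrightarrow> 0) (at x within S)"
  proof (rule Lim_null_comparison)
    show "eventually (\<lambda>y. norm ((?U y - ?U x) / (y - x) - ?q y * F x) \<le> \<bar>?q y\<bar> * \<bar>F y - F x\<bar>)
        (at x within S)"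
      using pos
    proof eventually_elim
      case (elim y)
      have "(?U y - ?U x) / (y - x) - ?q y * F x
          = (?U y - ?U x - (y powr \<alpha> - x powr \<alpha>) * F x) / (y - x)"
        by (simp add: diff_divide_distrib left_diff_distrib)
      then show ?case
        using close[of y] elim by (simp add: abs_divide divide_right_mono)
    qed
    show "((\<lambda>y. \<bar>?q y\<bar> * \<bar>F y - F x\<bar>) \<longlongrightarrow> 0) (at x within S)"
      using F0 by simp
  qed
  from tendsto_add[OF this tendsto_mult_right[OF q, of "F x"]]
  show ?thesis
    by (simp add: has_field_derivative_iff)
qed

text \<open>
  This is what makes the description of a Kendall convolution by its transform unambiguous. The right
  derivative of the primitive gives \<open>F\<close> on the positive half-line, right continuity gives the value at \<open>0\<close>.
\<close>

lemma williamson_inject: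
  assumes F1: "nonneg_distribution_function F1" and F2: "nonneg_distribution_function F2"
    and "\<alpha> > 0" and eq: "\<And>x. x > 0 \<Longrightarrow> williamson \<alpha> F1 x = williamson \<alpha> F2 x"
  shows "F1 = F2"
proof -
  have pos: "F1 x = F2 x" if "x > 0" for x
  proof -
    let ?U1 = "williamson_primitive \<alpha> F1" and ?U2 = "williamson_primitive \<alpha> F2"
    have D: "((\<lambda>y. (williamson_primitive \<alpha> F y - williamson_primitive \<alpha> F x) / (y - x))
        \<longlongrightarrow> \<alpha> * x powr (\<alpha> - 1) * F x) (at_right x)" if "nonneg_distribution_function F" for F
      using williamson_primitive_has_derivative[OF that \<open>\<alpha> > 0\<close> \<open>x > 0\<close>
          nonneg_distribution_function_right_cont[OF that]]
      by (simp add: has_field_derivative_iff)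
    have "eventually (\<lambda>y. (?U2 y - ?U2 x) / (y - x) = (?U1 y - ?U1 x) / (y - x)) (at_right x)"
      using that eq by (auto simp: eventually_at_filter williamson_primitive_eq)
    then have "((\<lambda>y. (?U1 y - ?U1 x) / (y - x)) \<longlongrightarrow> \<alpha> * x powr (\<alpha> - 1) * F2 x) (at_right x)"
      by (rule Lim_transform_eventually[OF D[OF F2]])
    then have "\<alpha> * x powr (\<alpha> - 1) * F1 x = \<alpha> * x powr (\<alpha> - 1) * F2 x"
      by (rule tendsto_unique[OF trivial_limit_at_right_real D[OF F1]])
    then show ?thesis using that \<open>\<alpha> > 0\<close> by simp
  qed
  have zero: "F1 0 = F2 0"
  proof (rule tendsto_unique[OF trivial_limit_at_right_real])
    show "(F1 \<longlongrightarrow> F1 0) (at_right 0)"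
      using nonneg_distribution_function_right_cont[OF F1] by (simp add: continuous_within)
    have "(F2 \<longlongrightarrow> F2 0) (at_right 0)"
      using nonneg_distribution_function_right_cont[OF F2] by (simp add: continuous_within)
    then show "(F1 \<longlongrightarrow> F2 0) (at_right 0)"
      by (rule Lim_transform_eventually) (simp add: eventually_at_filter pos)
  qed
  show ?thesis
  proof
    fix x
    show "F1 x = F2 x"
      using pos zero nonneg_distribution_function_neg[OF F1] nonneg_distribution_function_neg[OF F2]
      by (metis linorder_neqE_linordered_idom)
  qed
qed

section \<open>The convolution powers of a continuous distribution function\<close>

text \<open>
  The candidate for the convolution power of order \<open>n + 1\<close>, the order being shifted because the power
  of order \<open>0\<close> is the discontinuous unit step. Also
  \<open>G^(n+1) + (n + 1) * G^n * (F - G)\<close>, the image of \<open>G^(n+1)\<close> under the inversion formula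
  \<open>F x = G x + x * G' x / \<alpha>\<close>.
\<close>

definition kendall_power_formula :: "real \<Rightarrow> (real \<Rightarrow> real) \<Rightarrow> nat \<Rightarrow> real \<Rightarrow> real" where
  "kendall_power_formula \<alpha> F n x =
     real (Suc n) * williamson \<alpha> F x ^ n * F x - real n * williamson \<alpha> F x ^ Suc n"

text \<open>
  The derivative in \<open>g\<close> is \<open>n * (n + 1) * g^(n-1) * (f - g)\<close>, which is nonnegative only for
  \<open>g \<le> f\<close>. Hence \<open>f\<close> is raised to \<open>f'\<close> first and \<open>g\<close> to \<open>g'\<close> afterwards.
\<close>

lemma kendall_polynomial_mono:
  fixes g f g' f' :: real
  assumes "0 \<le> g" "g \<le> g'" "f \<le> f'" "g' \<le> f'"
  shows "real (Suc n) * g ^ n * f - real n * g ^ Suc n \<le> real (Suc n) * g' ^ n * f' - real n * g' ^ Suc n"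
proof -
  let ?H = "\<lambda>u. real (Suc n) * u ^ n * f' - real n * u ^ Suc n"
  have "real (Suc n) * g ^ n * f - real n * g ^ Suc n \<le> ?H g"
    using assms by (simp add: mult_left_mono)
  also have "?H g \<le> ?H g'"
  proof (rule DERIV_nonneg_imp_nondecreasing[OF \<open>g \<le> g'\<close>])
    fix u assume u: "g \<le> u" "u \<le> g'"
    have "(?H has_real_derivative real (Suc n) * (real n * u ^ (n - 1)) * (f' - u)) (at u)"
      by (cases n; rule derivative_eq_intros refl | simp add: algebra_simps)+
    moreover have "0 \<le> real (Suc n) * (real n * u ^ (n - 1)) * (f' - u)"
      using assms u by simp
    ultimately show "\<exists>D. (?H has_real_derivative D) (at u) \<and> 0 \<le> D" by blast
  qed
  finally show ?thesis .
qed

context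
  fixes \<alpha> :: real and F :: "real \<Rightarrow> real"
  assumes F: "nonneg_distribution_function F" and cont: "continuous_on UNIV F" and pos: "\<alpha> > 0"
begin

lemma continuous_distribution_function_nonpos:
  assumes "x \<le> 0"
  shows "F x = 0"
proof (cases "x = 0")
  case True
  have "(F \<longlongrightarrow> F 0) (at_left 0)"
    using cont by (simp add: continuous_on_def tendsto_within_subset[of F _ 0 UNIV])
  moreover have "(F \<longlongrightarrow> 0) (at_left 0)"
    using F by (simp add: nonneg_distribution_function_def)
  ultimately show ?thesis
    using True by (auto intro: tendsto_unique[OF trivial_limit_at_left_real])
next
  case False
  then show ?thesis using assms nonneg_distribution_function_neg[OF F] by simp
qed

lemma williamson_nonpos:
  assumes "x \<le> 0"
  shows "williamson \<alpha> F x = 0"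
proof -
  have "williamson \<alpha> F x = (LINT t|interval_measure F. indicator {0..x} t)"
    unfolding williamson_def set_lebesgue_integral_def
    by (rule Bochner_Integration.integral_cong) (use assms in \<open>auto simp: indicator_def\<close>)
  also have "\<dots> = F x"
    using interval_measure_atLeastAtMost_0[OF F, of x] by simp
  finally show ?thesis using continuous_distribution_function_nonpos[OF assms] by simp
qed

lemma williamson_bounds: "0 \<le> williamson \<alpha> F x" "williamson \<alpha> F x \<le> F x"
proof -
  have "0 \<le> williamson \<alpha> F x \<and> williamson \<alpha> F x \<le> F x"
  proof (cases "x > 0")
    case True
    then show ?thesis
      using williamson_primitive_bounds[OF F pos, of x]
      by (simp add: williamson_primitive_eq zero_le_mult_iff mult_le_cancel_left)
  next
    case False
    then show ?thesis
      by (simp add: williamson_nonpos continuous_distribution_function_nonpos)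
  qed
  then show "0 \<le> williamson \<alpha> F x" "williamson \<alpha> F x \<le> F x" by auto
qed

lemma williamson_mono:
  assumes "x \<le> y"
  shows "williamson \<alpha> F x \<le> williamson \<alpha> F y"
proof (cases "x > 0")
  case True
  let ?G = "williamson \<alpha> F"
  have "x powr \<alpha> \<le> y powr \<alpha>" using True assms pos by (intro powr_mono2) auto
  then have "(y powr \<alpha> - x powr \<alpha>) * ?G x \<le> (y powr \<alpha> - x powr \<alpha>) * F x"
    using williamson_bounds by (intro mult_left_mono) auto
  also have "\<dots> \<le> y powr \<alpha> * ?G y - x powr \<alpha> * ?G x"
    using williamson_primitive_increment(1)[OF F pos, of x y] True assms
    by (simp add: williamson_primitive_eq)
  finally have "y powr \<alpha> * ?G x \<le> y powr \<alpha> * ?G y" by (simp add: algebra_simps)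
  then show ?thesis using True assms by simp
next
  case False
  then show ?thesis using williamson_bounds by (simp add: williamson_nonpos)
qed

text \<open>
  Some \<open>e\<close> below \<open>x\<close> has \<open>F e < 1\<close>, as \<open>F\<close> vanishes at \<open>0\<close>. Up to \<open>e\<close> the primitive loses at least
  \<open>e powr \<alpha> * (1 - F e)\<close> against \<open>e powr \<alpha>\<close>, and it cannot make up for that later because \<open>F \<le> 1\<close>.
\<close>

lemma williamson_less_1:
  assumes "x > 0"
  shows "williamson \<alpha> F x < 1"
proof -
  have "(F \<longlongrightarrow> 0) (at_right 0)"
    using nonneg_distribution_function_right_cont[OF F, of 0] continuous_distribution_function_nonpos[of 0]
    by (simp add: continuous_within)
  then have "eventually (\<lambda>e. F e < 1) (at_right 0)"
    by (rule order_tendstoD) simp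
  moreover have "eventually (\<lambda>e. e \<in> {0<..<x}) (at_right 0)"
    using assms by (rule eventually_at_right_real)
  ultimately have "eventually (\<lambda>e. F e < 1 \<and> e \<in> {0<..<x}) (at_right 0)"
    by (rule eventually_conj)
  then obtain e where e: "F e < 1" "0 < e" "e < x"
    using eventually_happens'[OF trivial_limit_at_right_real] by fastforce
  have less: "e powr \<alpha> < x powr \<alpha>" using e pos by (intro powr_less_mono2) auto
  have "x powr \<alpha> * williamson \<alpha> F x
      \<le> e powr \<alpha> * williamson \<alpha> F e + (x powr \<alpha> - e powr \<alpha>) * F x"
    using williamson_primitive_increment(2)[OF F pos, of e x] e assms
    by (simp add: williamson_primitive_eq)
  also have "\<dots> \<le> e powr \<alpha> * F e + (x powr \<alpha> - e powr \<alpha>) * 1"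
    using less williamson_bounds[of e] nonneg_distribution_function_le_1[OF F, of x]
    by (intro add_mono mult_left_mono) auto
  also have "\<dots> < x powr \<alpha> * 1"
    using e by (simp add: algebra_simps)
  finally show ?thesis using assms by simp
qed

lemma williamson_continuous: "isCont (williamson \<alpha> F) x"
proof (cases x "0::real" rule: linorder_cases)
  case greater
  have ev: "eventually (\<lambda>y. williamson_primitive \<alpha> F y / y powr \<alpha> = williamson \<alpha> F y) (nhds x)"
    by (rule eventually_mono[OF eventually_nhds_in_open[OF open_greaterThan[of 0]]])
      (use greater in \<open>auto simp: williamson_primitive_eq\<close>)
  have "isCont F x" using cont by (simp add: continuous_on_eq_continuous_at)
  then have "isCont (williamson_primitive \<alpha> F) x"
    by (rule DERIV_isCont[OF williamson_primitive_has_derivative[OF F pos greater]])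
  then have "isCont (\<lambda>y. williamson_primitive \<alpha> F y / y powr \<alpha>) x"
    using greater by (intro continuous_intros) auto
  then show ?thesis
    using isCont_cong[OF ev] by simp
next
  case less
  have "eventually (\<lambda>y. 0 = williamson \<alpha> F y) (nhds x)"
    by (rule eventually_mono[OF eventually_nhds_in_open[OF open_lessThan[of 0]]])
      (use less in \<open>auto simp: williamson_nonpos\<close>)
  from isCont_cong[OF this] show ?thesis by simp
next
  case equal
  have "isCont F 0" using cont by (simp add: continuous_on_eq_continuous_at)
  then have "(F \<longlongrightarrow> 0) (at 0)"
    by (simp add: isCont_def continuous_distribution_function_nonpos)
  then have "(williamson \<alpha> F \<longlongrightarrow> 0) (at 0)"
    by (rule Lim_null_comparison[rotated]) (simp add: williamson_bounds)
  then show ?thesis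
    by (simp add: equal isCont_def williamson_nonpos)
qed

text \<open>
  The lower increment bound between \<open>sqrt y\<close> and \<open>y\<close> suffices: \<open>sqrt y\<close> tends to infinity, but
  \<open>sqrt y powr \<alpha>\<close> is negligible compared with \<open>y powr \<alpha>\<close>.
\<close>

lemma williamson_at_top: "(williamson \<alpha> F \<longlongrightarrow> 1) at_top"
proof (rule tendsto_sandwich)
  show "eventually (\<lambda>y. (1 - y powr (- \<alpha> / 2)) * F (sqrt y) \<le> williamson \<alpha> F y) at_top"
    using eventually_gt_at_top[of 1]
  proof eventually_elim
    case (elim y)
    have sq: "sqrt y powr \<alpha> = y powr (- \<alpha> / 2) * y powr \<alpha>"
      using elim by (simp add: powr_half_sqrt[symmetric] powr_powr powr_add[symmetric])
    have "sqrt y \<le> y" using elim real_sqrt_le_iff[of y "y\<^sup>2"] by (simp add: power2_eq_square)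
    then have "(y powr \<alpha> - sqrt y powr \<alpha>) * F (sqrt y)
        \<le> y powr \<alpha> * williamson \<alpha> F y - williamson_primitive \<alpha> F (sqrt y)"
      using williamson_primitive_increment(1)[OF F pos, of "sqrt y" y] elim
      by (simp add: williamson_primitive_eq[of y])
    then have "y powr \<alpha> * ((1 - y powr (- \<alpha> / 2)) * F (sqrt y)) \<le> y powr \<alpha> * williamson \<alpha> F y"
      using williamson_primitive_bounds(1)[OF F pos, of "sqrt y"] elim
      unfolding sq by (simp add: algebra_simps)
    then show ?case using elim by simp
  qed
  have "((\<lambda>y. (1 - y powr (- \<alpha> / 2)) * F (sqrt y)) \<longlongrightarrow> (1 - 0) * 1) at_top"
    using pos
    by (intro tendsto_intros tendsto_neg_powr filterlim_ident
        filterlim_compose[OF nonneg_distribution_function_at_top[OF F] sqrt_at_top]) auto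
  then show "((\<lambda>y. (1 - y powr (- \<alpha> / 2)) * F (sqrt y)) \<longlongrightarrow> 1) at_top" by simp
  show "eventually (\<lambda>y. williamson \<alpha> F y \<le> 1) at_top"
    by (intro always_eventually allI order_trans[OF williamson_bounds(2) nonneg_distribution_function_le_1[OF F]])
qed simp

lemma kendall_power_formula_nonpos: "x \<le> 0 \<Longrightarrow> kendall_power_formula \<alpha> F n x = 0"
  by (simp add: kendall_power_formula_def continuous_distribution_function_nonpos williamson_nonpos)

lemma kendall_power_formula_continuous: "isCont (kendall_power_formula \<alpha> F n) x"
proof -
  have "isCont F x" using cont by (simp add: continuous_on_eq_continuous_at)
  then show ?thesis
    unfolding kendall_power_formula_def by (intro continuous_intros williamson_continuous)
qed

lemma kendall_power_formula_distribution:
  "nonneg_distribution_function (kendall_power_formula \<alpha> F n)"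
proof (rule nonneg_distribution_functionI)
  show "kendall_power_formula \<alpha> F n x \<le> kendall_power_formula \<alpha> F n y" if "x \<le> y" for x y
    unfolding kendall_power_formula_def using that
    by (intro kendall_polynomial_mono williamson_bounds williamson_mono
        nonneg_distribution_function_mono[OF F])
  show "continuous (at_right x) (kendall_power_formula \<alpha> F n)" for x
    using kendall_power_formula_continuous by (rule continuous_within_subset) simp
  show "kendall_power_formula \<alpha> F n x = 0" if "x < 0" for x
    using that by (simp add: kendall_power_formula_nonpos)
  have "(kendall_power_formula \<alpha> F n \<longlongrightarrow> real (Suc n) * 1 ^ n * 1 - real n * 1 ^ Suc n) at_top"
    unfolding kendall_power_formula_def
    by (intro tendsto_intros williamson_at_top nonneg_distribution_function_at_top[OF F])
  then show "(kendall_power_formula \<alpha> F n \<longlongrightarrow> 1) at_top" by simp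
qed

text \<open>
  Both sides, multiplied by \<open>x powr \<alpha>\<close>, have derivative \<open>\<alpha> * x powr (\<alpha> - 1)\<close> times the candidate,
  so that they differ by a constant on the positive half-line. Both are at most
  \<open>x powr \<alpha>\<close>, hence tend to \<open>0\<close> at \<open>0\<close>, and the constant is \<open>0\<close>.
\<close>

lemma williamson_kendall_power_formula:
  assumes "x > 0"
  shows "williamson \<alpha> (kendall_power_formula \<alpha> F n) x = williamson \<alpha> F x ^ Suc n"
proof -
  let ?K = "kendall_power_formula \<alpha> F n" and ?G = "williamson \<alpha> F"
  let ?U = "williamson_primitive \<alpha> F" and ?V = "williamson_primitive \<alpha> ?K"
  let ?D = "\<lambda>x. ?V x - x powr \<alpha> * (?U x / x powr \<alpha>) ^ Suc n"
  note K = kendall_power_formula_distribution[of n]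
  have G: "?U y / y powr \<alpha> = ?G y" if "y > 0" for y
    using that by (simp add: williamson_primitive_eq)
  have deriv: "(?D has_real_derivative 0) (at y)" if "y > 0" for y
  proof -
    define p where "p = \<alpha> * y powr (\<alpha> - 1)"
    have P: "y powr \<alpha> \<noteq> 0" using that by simp
    have dP: "((\<lambda>y. y powr \<alpha>) has_real_derivative p) (at y)"
      unfolding p_def using that by (rule has_real_derivative_powr)
    have dU: "(?U has_real_derivative p * F y) (at y)"
      unfolding p_def using cont
      by (intro williamson_primitive_has_derivative F pos that)
        (simp add: continuous_on_eq_continuous_at)
    have dV: "(?V has_real_derivative p * ?K y) (at y)"
      unfolding p_def
      by (intro williamson_primitive_has_derivative K pos that kendall_power_formula_continuous)
    have dQ: "((\<lambda>y. ?U y / y powr \<alpha>) has_real_derivative p * (F y - ?G y) / y powr \<alpha>) (at y)"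
    proof -
      have "?U y = y powr \<alpha> * ?G y" using that by (rule williamson_primitive_eq)
      then have "(p * F y * y powr \<alpha> - ?U y * p) / (y powr \<alpha> * y powr \<alpha>) = p * (F y - ?G y) / y powr \<alpha>"
        using P by (simp add: divide_simps) (simp add: algebra_simps)
      then show ?thesis using DERIV_divide[OF dU dP P] by simp
    qed
    have "(?D has_real_derivative p * ?K y - (p * (?U y / y powr \<alpha>) ^ Suc n
        + real (Suc n) * (p * (F y - ?G y) / y powr \<alpha>) * (?U y / y powr \<alpha>) ^ n * y powr \<alpha>)) (at y)"
      using DERIV_diff[OF dV DERIV_mult[OF dP DERIV_power[OF dQ, of "Suc n"]]]
      by (simp add: algebra_simps)
    moreover have "p * ?K y - (p * (?U y / y powr \<alpha>) ^ Suc n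
        + real (Suc n) * (p * (F y - ?G y) / y powr \<alpha>) * (?U y / y powr \<alpha>) ^ n * y powr \<alpha>) = 0"
      unfolding G[OF that] kendall_power_formula_def using P by (simp add: field_simps)
    ultimately show ?thesis by simp
  qed
  have const: "?D y = ?D x" if "0 < y" for y
    using assms that deriv by (intro DERIV_isconst3[of 0 "x + y + 1"]) auto
  have "(?D \<longlongrightarrow> 0) (at_right 0)"
  proof (rule Lim_null_comparison)
    show "eventually (\<lambda>y. norm (?D y) \<le> y powr \<alpha>) (at_right 0)"
      unfolding eventually_at_filter
    proof (intro always_eventually allI impI)
      fix y :: real assume "y \<in> {0<..}"
      then have y: "y > 0" by simp
      have V: "0 \<le> ?V y" "?V y \<le> y powr \<alpha> * ?K y"
        using williamson_primitive_bounds[OF K pos, of y] y by auto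
      have "y powr \<alpha> * ?K y \<le> y powr \<alpha>"
        using nonneg_distribution_function_le_1[OF K] by (simp add: mult_left_le)
      moreover have "0 \<le> ?G y ^ Suc n" "?G y ^ Suc n \<le> 1"
        using williamson_bounds[of y] williamson_less_1[OF y]
        by (simp_all add: power_le_one del: power_Suc)
      then have "0 \<le> y powr \<alpha> * ?G y ^ Suc n" "y powr \<alpha> * ?G y ^ Suc n \<le> y powr \<alpha>"
        by (simp_all add: mult_left_le del: power_Suc)
      ultimately show "norm (?D y) \<le> y powr \<alpha>"
        unfolding G[OF y] using V by simp
    qed
    show "((\<lambda>y. y powr \<alpha>) \<longlongrightarrow> 0) (at_right 0)"
      using pos by (intro tendsto_zero_powrI[where b = \<alpha>] tendsto_intros)
        (auto simp: eventually_at_filter)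
  qed
  moreover have "(?D \<longlongrightarrow> ?D x) (at_right 0)"
    by (intro tendsto_eventually eventually_mono[OF eventually_at_right_less] const)
  ultimately have "?D x = 0"
    by (intro tendsto_unique[OF trivial_limit_at_right_real, of ?D "?D x" 0])
  then show ?thesis
    using assms unfolding G[OF assms] by (simp add: williamson_primitive_eq)
qed

text \<open>
  For \<open>t \<ge> 0\<close> the integrands are \<open>min (x powr \<alpha>) (t powr \<alpha>)\<close> and
  \<open>x powr \<alpha>\<close> restricted to \<open>t > x\<close>. Both are dominated by \<open>t powr \<alpha>\<close>, and for \<open>x \<ge> t\<close> they have
  reached their limits \<open>t powr \<alpha>\<close> and \<open>0\<close>.
\<close>

lemma tail_moment_limits:
  assumes int: "integrable (interval_measure F) (\<lambda>t. t powr \<alpha>)"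
  shows "((\<lambda>x. x powr \<alpha> * (1 - williamson \<alpha> F x)) \<longlongrightarrow> moment \<alpha> F) at_top"
    and "((\<lambda>x. x powr \<alpha> * (1 - F x)) \<longlongrightarrow> 0) at_top"
proof -
  let ?\<mu> = "interval_measure F"
  interpret real_distribution ?\<mu>
    using F by (rule nonneg_distribution_function_measure)
  let ?h = "\<lambda>x t. indicator {0..x} t *\<^sub>R (x powr \<alpha> - t powr \<alpha>)"
  have mono: "s powr \<alpha> \<le> t powr \<alpha>" if "0 \<le> s" "s \<le> t" for s t :: real
    using that pos by (intro powr_mono2) auto
  have mom: "moment \<alpha> F = (LINT t|?\<mu>. t powr \<alpha>)"
    unfolding moment_def set_lebesgue_integral_def
    by (rule integral_cong_AE) (use AE_interval_measure_nonneg[OF F] in \<open>auto simp: indicator_def\<close>)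
  have "((\<lambda>x. LINT t|?\<mu>. x powr \<alpha> - ?h x t) \<longlongrightarrow> (LINT t|?\<mu>. t powr \<alpha>)) at_top"
  proof (rule integral_dominated_convergence_at_top[OF _ _ int])
    show "AE t in ?\<mu>. ((\<lambda>x. x powr \<alpha> - ?h x t) \<longlongrightarrow> t powr \<alpha>) at_top"
      using AE_interval_measure_nonneg[OF F]
    proof eventually_elim
      case (elim t)
      show ?case
        by (intro tendsto_eventually eventually_mono[OF eventually_ge_at_top[of t]]) (use elim in simp)
    qed
    show "eventually (\<lambda>x. AE t in ?\<mu>. norm (x powr \<alpha> - ?h x t) \<le> t powr \<alpha>) at_top"
      using eventually_ge_at_top[of 0]
    proof eventually_elim
      case (elim x)
      show ?case
        using AE_interval_measure_nonneg[OF F]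
        by eventually_elim (use elim mono in \<open>auto simp: indicator_def\<close>)
    qed
  qed measurable
  moreover have "eventually (\<lambda>x. (LINT t|?\<mu>. x powr \<alpha> - ?h x t) = x powr \<alpha> * (1 - williamson \<alpha> F x)) at_top"
    using eventually_gt_at_top[of 0]
  proof eventually_elim
    case (elim x)
    have "(LINT t|?\<mu>. x powr \<alpha> - ?h x t) = x powr \<alpha> - (LINT t|?\<mu>. ?h x t)"
      using set_integrable_powr_deficit[OF F pos, of x] prob_space
      by (subst Bochner_Integration.integral_diff) (simp_all add: set_integrable_def)
    also have "(LINT t|?\<mu>. ?h x t) = x powr \<alpha> * williamson \<alpha> F x"
      using williamson_primitive_eq[OF elim]
      by (simp add: williamson_primitive_def set_lebesgue_integral_def)
    finally show ?case by (simp add: algebra_simps)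
  qed
  ultimately show "((\<lambda>x. x powr \<alpha> * (1 - williamson \<alpha> F x)) \<longlongrightarrow> moment \<alpha> F) at_top"
    unfolding mom by (rule Lim_transform_eventually)
  have "((\<lambda>x. LINT t|?\<mu>. x powr \<alpha> * (1 - indicator {0..x} t)) \<longlongrightarrow> (LINT t|?\<mu>. 0)) at_top"
  proof (rule integral_dominated_convergence_at_top[OF _ _ int])
    show "AE t in ?\<mu>. ((\<lambda>x. x powr \<alpha> * (1 - indicator {0..x} t)) \<longlongrightarrow> 0) at_top"
      using AE_interval_measure_nonneg[OF F]
    proof eventually_elim
      case (elim t)
      show ?case
        by (intro tendsto_eventually eventually_mono[OF eventually_ge_at_top[of t]]) (use elim in simp)
    qed
    show "eventually (\<lambda>x. AE t in ?\<mu>. norm (x powr \<alpha> * (1 - indicator {0..x} t)) \<le> t powr \<alpha>) at_top"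
      using eventually_ge_at_top[of 0]
    proof eventually_elim
      case (elim x)
      show ?case
        using AE_interval_measure_nonneg[OF F]
        by eventually_elim (use elim mono in \<open>auto simp: indicator_def\<close>)
    qed
  qed measurable
  also have "(\<lambda>x. LINT t|?\<mu>. x powr \<alpha> * (1 - indicator {0..x} t)) = (\<lambda>x. x powr \<alpha> * (1 - F x))"
    using prob_space
    by (simp add: interval_measure_atLeastAtMost_0[OF F] Bochner_Integration.integral_diff less_top[symmetric])
  finally show "((\<lambda>x. x powr \<alpha> * (1 - F x)) \<longlongrightarrow> 0) at_top"
    by simp
qed

text \<open>
  The moment is the limit of \<open>x powr \<alpha> * (1 - williamson \<alpha> F x)\<close>, which increases in \<open>x\<close> and is
  already positive at \<open>x = 1\<close>.
\<close>

lemma moment_pos: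
  assumes "integrable (interval_measure F) (\<lambda>t. t powr \<alpha>)"
  shows "moment \<alpha> F > 0"
proof -
  have "eventually (\<lambda>x. 1 - williamson \<alpha> F 1 \<le> x powr \<alpha> * (1 - williamson \<alpha> F x)) at_top"
    using eventually_ge_at_top[of 1]
  proof eventually_elim
    case (elim x)
    have "x powr \<alpha> * williamson \<alpha> F x - williamson \<alpha> F 1 \<le> (x powr \<alpha> - 1) * F x"
      using williamson_primitive_increment(2)[OF F pos, of 1 x] elim
      by (simp add: williamson_primitive_eq)
    also have "\<dots> \<le> (x powr \<alpha> - 1) * 1"
      using elim pos nonneg_distribution_function_le_1[OF F]
      by (intro mult_left_mono) (auto simp: ge_one_powr_ge_zero)
    finally show ?case by (simp add: algebra_simps)
  qed
  then have "1 - williamson \<alpha> F 1 \<le> moment \<alpha> F"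
    by (rule tendsto_lowerbound[OF tail_moment_limits(1)[OF assms]]) simp
  then show ?thesis using williamson_less_1[of 1] by simp
qed

lemma kendall_conv_eqI:
  assumes "nonneg_distribution_function K"
    and "\<And>x. x > 0 \<Longrightarrow> williamson \<alpha> K x = williamson \<alpha> F1 x * williamson \<alpha> F2 x"
  shows "kendall_conv \<alpha> F1 F2 = K"
  unfolding kendall_conv_def
  by (rule the_equality) (use assms pos in \<open>auto intro: williamson_inject\<close>)

lemma williamson_return_0:
  assumes "x > 0"
  shows "williamson \<alpha> (cdf (return borel 0)) x = 1"
proof -
  have "real_distribution (return borel (0::real))"
    by (simp add: real_distribution_def real_distribution_axioms_def prob_space_return)
  then interpret real_distribution "return borel (0::real)" .
  have "(cdf (return borel 0) \<longlongrightarrow> 0) (at_left 0)"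
    using cdf_at_left[of 0] by (simp add: measure_return)
  then have nn: "nonneg_distribution_function (cdf (return borel 0))"
    unfolding nonneg_distribution_function_def using real_distribution_axioms by blast
  have "interval_measure (cdf (return borel 0)) = return borel 0"
    by (intro cdf_unique nonneg_distribution_function_measure[OF nn] real_distribution_axioms)
  then show ?thesis
    unfolding williamson_def set_lebesgue_integral_def using assms pos
    by (simp add: integral_return)
qed

lemma kendall_power_Suc: "kendall_power \<alpha> F (Suc n) = kendall_power_formula \<alpha> F n"
proof (induction n)
  case 0
  show ?case
    unfolding kendall_power.simps
    by (rule kendall_conv_eqI[OF kendall_power_formula_distribution])
      (simp add: williamson_kendall_power_formula williamson_return_0)
next
  case (Suc n)
  have "kendall_conv \<alpha> (kendall_power_formula \<alpha> F n) F = kendall_power_formula \<alpha> F (Suc n)"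
    by (rule kendall_conv_eqI[OF kendall_power_formula_distribution])
      (simp add: williamson_kendall_power_formula)
  then show ?case using Suc by simp
qed

lemma kendall_power_sums:
  assumes "x > 0"
  shows "(\<lambda>n. kendall_power \<alpha> F n x) sums
    (2 / (1 - williamson \<alpha> F x) - (1 - F x) / (1 - williamson \<alpha> F x)\<^sup>2)"
proof -
  define G where "G = williamson \<alpha> F x"
  have G: "0 \<le> G" "G < 1"
    using williamson_bounds[of x] williamson_less_1[OF assms] by (auto simp: G_def)
  have "(\<lambda>n. real (Suc n) * G ^ n) sums (1 / (1 - G)\<^sup>2)"
    using geometric_deriv_sums[of G] G by simp
  moreover have "(\<lambda>n. G ^ n) sums (1 / (1 - G))"
    using geometric_sums[of G] G by simp
  \<comment> \<open>The term \<open>n * G^(n+1)\<close> is written as \<open>G * ((n + 1) * G^n - G^n)\<close> to reuse the two series.\<close>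
  ultimately have "(\<lambda>n. real (Suc n) * G ^ n * F x - G * (real (Suc n) * G ^ n - G ^ n))
      sums (1 / (1 - G)\<^sup>2 * F x - G * (1 / (1 - G)\<^sup>2 - 1 / (1 - G)))"
    by (intro sums_diff sums_mult sums_mult2)
  then have "(\<lambda>n. kendall_power \<alpha> F (Suc n) x) sums
      (1 / (1 - G)\<^sup>2 * F x - G * (1 / (1 - G)\<^sup>2 - 1 / (1 - G)))"
    unfolding kendall_power_Suc kendall_power_formula_def G_def[symmetric]
    by (simp add: algebra_simps)
  then have "(\<lambda>n. kendall_power \<alpha> F n x) sums
      (1 / (1 - G)\<^sup>2 * F x - G * (1 / (1 - G)\<^sup>2 - 1 / (1 - G)) + kendall_power \<alpha> F 0 x)"
    by (subst (asm) sums_Suc_iff) simp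
  moreover have "kendall_power \<alpha> F 0 x = 1"
    using assms by (simp add: cdf_def measure_return)
  moreover have "1 / (1 - G)\<^sup>2 * F x - G * (1 / (1 - G)\<^sup>2 - 1 / (1 - G)) + 1
      = 2 / (1 - G) - (1 - F x) / (1 - G)\<^sup>2"
  proof -
    have "G \<noteq> 1" using G by simp
    then show ?thesis by (simp add: divide_simps power2_eq_square) (simp add: algebra_simps)
  qed
  ultimately show ?thesis by (simp add: G_def)
qed

lemma kendall_renewal_asymptotics:
  assumes int: "integrable (interval_measure F) (\<lambda>t. t powr \<alpha>)"
  shows "((\<lambda>x. kendall_renewal \<alpha> F x / x powr \<alpha>) \<longlongrightarrow> 2 / moment \<alpha> F) at_top"
proof -
  let ?V = "\<lambda>x. x powr \<alpha> * (1 - williamson \<alpha> F x)"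
  have "((\<lambda>x. 2 / ?V x - x powr \<alpha> * (1 - F x) / (?V x)\<^sup>2)
      \<longlongrightarrow> 2 / moment \<alpha> F - 0 / (moment \<alpha> F)\<^sup>2) at_top"
    using moment_pos[OF int] by (intro tendsto_intros tail_moment_limits int) auto
  moreover have "eventually (\<lambda>x. 2 / ?V x - x powr \<alpha> * (1 - F x) / (?V x)\<^sup>2
      = kendall_renewal \<alpha> F x / x powr \<alpha>) at_top"
    using eventually_gt_at_top[of 0]
  proof eventually_elim
    case (elim x)
    have "1 - williamson \<alpha> F x \<noteq> 0" "x powr \<alpha> \<noteq> 0"
      using williamson_less_1[OF elim] elim by auto
    moreover have "kendall_renewal \<alpha> F x
        = 2 / (1 - williamson \<alpha> F x) - (1 - F x) / (1 - williamson \<alpha> F x)\<^sup>2"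
      unfolding kendall_renewal_def using kendall_power_sums[OF elim] by (rule sums_unique[symmetric])
    ultimately show ?case
      by (simp add: power2_eq_square diff_divide_distrib mult_ac)
  qed
  ultimately show ?thesis
    by (simp add: Lim_transform_eventually)
qed

end

section \<open>The renewal function\<close>

lemma nonneg_distribution_function_positive_rv:
  assumes "prob_space M" "X \<in> borel_measurable M" "AE \<omega> in M. X \<omega> > 0"
  shows "nonneg_distribution_function (cdf (distr M borel X))"
proof -
  interpret prob_space M by fact
  interpret D: real_distribution "distr M borel X"
    using assms(2) by (rule real_distribution_distr)
  have "measure (distr M borel X) {..<0} = prob (X -` {..<0} \<inter> space M)"
    using assms(2) by (rule measure_distr) simp
  also have "\<dots> = 0"
    using assms(2,3) by (subst prob_eq_0) (auto elim!: eventually_mono)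
  finally have "(cdf (distr M borel X) \<longlongrightarrow> 0) (at_left 0)"
    using D.cdf_at_left[of 0] by simp
  then show ?thesis
    unfolding nonneg_distribution_function_def using D.real_distribution_axioms by blast
qed

theorem proposition5:
  fixes M :: "'a measure" and X :: "'a \<Rightarrow> real" and F :: "real \<Rightarrow> real" and \<alpha> :: real
  assumes "\<alpha> > 0"
    and "prob_space M"
    and "X \<in> borel_measurable M"
    and "AE \<omega> in M. X \<omega> > 0"
    and "F = cdf (distr M borel X)"
    and "continuous_on UNIV F"
    and "integrable M (\<lambda>\<omega>. X \<omega> powr \<alpha>)"
  shows "(\<forall>x>0. summable (\<lambda>n. kendall_power \<alpha> F n x) \<and>
            kendall_renewal \<alpha> F x =
              2 / (1 - williamson \<alpha> F x) - (1 - F x) / (1 - williamson \<alpha> F x)\<^sup>2) \<and>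
         ((\<lambda>x. kendall_renewal \<alpha> F x / x powr \<alpha>) \<longlongrightarrow> 2 / moment \<alpha> F) at_top"
proof -
  have F: "nonneg_distribution_function F"
    unfolding assms(5) using assms(2-4) by (rule nonneg_distribution_function_positive_rv)
  interpret prob_space M by fact
  have "cdf (interval_measure F) = cdf (distr M borel X)"
    using nonneg_distribution_function_measure(2)[OF F] assms(5) by simp
  then have "interval_measure F = distr M borel X"
    using assms(3) nonneg_distribution_function_measure(1)[OF F]
    by (intro cdf_unique real_distribution_distr)
  then have int: "integrable (interval_measure F) (\<lambda>t. t powr \<alpha>)"
    using assms(3,7) by (simp add: integrable_distr_eq)
  note sums = kendall_power_sums[OF F assms(6) \<open>\<alpha> > 0\<close>]
  have "summable (\<lambda>n. kendall_power \<alpha> F n x) \<and>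
      kendall_renewal \<alpha> F x =
        2 / (1 - williamson \<alpha> F x) - (1 - F x) / (1 - williamson \<alpha> F x)\<^sup>2" if "x > 0" for x
    unfolding kendall_renewal_def
    using sums_summable[OF sums[OF that]] sums_unique[OF sums[OF that]] by simp
  moreover have "((\<lambda>x. kendall_renewal \<alpha> F x / x powr \<alpha>) \<longlongrightarrow> 2 / moment \<alpha> F) at_top"
    using F assms(6) \<open>\<alpha> > 0\<close> int by (rule kendall_renewal_asymptotics)
  ultimately show ?thesis by blast
qed

end
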